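(* Every automorphism of the infinite Kneser graph $K_{\infty}$ is induced by a permutation of $\mathbb{N}$; that is, for every automorphism $f$ of $K_{\infty}$ there exists a permutation $s$ of $\mathbb{N}$ such that $f(X)=s(X)$ for every vertex $X$ of $K_{\infty}$.
   Context: The infinite Kneser graph $K_{\infty}$ is the simple graph whose vertices are all subsets $X\subset\mathbb{N}$ with $|X|=|\mathbb{N}\setminus X|=\infty$; two vertices are adjacent if they are disjoint subsets of $\mathbb{N}$. For a permutation $s$ of $\mathbb{N}$, $s(X)=\{s(x):x\in X\}$. *)

theory Defs
  imports "Graph_Theory.Graph_Theory"
begin

text \<open>Simple graphs, possibly infinite, are modelled as in the Graph_Theory library
  by \<open>pair_bidirected_digraph\<close>: an edge between \<open>u\<close> and \<open>v\<close> is the pair of arcs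
  \<open>(u, v)\<close> and \<open>(v, u)\<close>. (The library's \<open>pair_graph\<close> also demands finiteness.)\<close>

definition kneser_inf :: "nat set pair_pre_digraph" where
  "kneser_inf =
    (let V = {X. infinite X \<and> infinite (UNIV - X)}
     in \<lparr> pverts = V, parcs = {(X, Y). X \<in> V \<and> Y \<in> V \<and> X \<inter> Y = {}} \<rparr>)"

text \<open>An automorphism is represented by a total function whose values off the vertex set
  are irrelevant.\<close>

definition graph_automorphism :: "'a pair_pre_digraph \<Rightarrow> ('a \<Rightarrow> 'a) \<Rightarrow> bool" where
  "graph_automorphism G f \<longleftrightarrow>
    bij_betw f (pverts G) (pverts G) \<and>
    (\<forall>u \<in> pverts G. \<forall>v \<in> pverts G. (f u, f v) \<in> parcs G \<longleftrightarrow> (u, v) \<in> parcs G)"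

lemma pverts_kneser_inf: "pverts kneser_inf = {X. infinite X \<and> infinite (UNIV - X)}"
  by (simp add: kneser_inf_def)

lemma parcs_kneser_inf:
  "(X, Y) \<in> parcs kneser_inf \<longleftrightarrow> X \<in> pverts kneser_inf \<and> Y \<in> pverts kneser_inf \<and> X \<inter> Y = {}"
  by (simp add: kneser_inf_def)

lemma pair_bidirected_digraph_kneser_inf: "pair_bidirected_digraph kneser_inf"
  by unfold_locales (auto simp: kneser_inf_def symmetric_conv)

text \<open>On well-formed graphs, the automorphisms are the vertex maps of those isomorphisms,
  in the library's sense, that map the graph onto itself.\<close>

lemma graph_automorphism_iff_digraph_isomorphism:
  assumes "pair_wf_digraph G"
  shows "graph_automorphism G f \<longleftrightarrow>
    (\<exists>h. iso_verts h = f \<and> pre_digraph.digraph_isomorphism (with_proj G) h \<and>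
         app_iso h (with_proj G) = with_proj G)"
proof -
  interpret pair_wf_digraph G by (rule assms)
  have V: "u \<in> pverts G" "v \<in> pverts G" if "(u, v) \<in> parcs G" for u v
    using in_arcsD1[OF that] in_arcsD2[OF that] by auto
  show ?thesis
  proof
    assume a: "graph_automorphism G f"
    then have inj: "inj_on f (pverts G)" and im: "f ` pverts G = pverts G"
      and adj: "\<And>u v. u \<in> pverts G \<Longrightarrow> v \<in> pverts G \<Longrightarrow> (f u, f v) \<in> parcs G \<longleftrightarrow> (u, v) \<in> parcs G"
      by (auto simp: graph_automorphism_def bij_betw_def)
    let ?g = "\<lambda>(u, v). (f u, f v)"
    let ?h = "\<lparr> iso_verts = f, iso_arcs = ?g, iso_head = snd, iso_tail = fst \<rparr>"
    have "inj_on ?g (parcs G)"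
      using inj V by (auto intro!: inj_onI dest: inj_onD)
    moreover have "?g ` parcs G = parcs G"
    proof
      show "?g ` parcs G \<subseteq> parcs G" using adj V by auto
      show "parcs G \<subseteq> ?g ` parcs G"
      proof
        fix e assume e: "e \<in> parcs G"
        obtain x y where xy: "e = (x, y)" by (cases e)
        with e V have "x \<in> f ` pverts G" "y \<in> f ` pverts G" by (auto simp: im)
        then obtain u v where "u \<in> pverts G" "x = f u" "v \<in> pverts G" "y = f v" by blast
        with e xy adj show "e \<in> ?g ` parcs G" by (force intro: rev_image_eqI)
      qed
    qed
    ultimately have "pre_digraph.digraph_isomorphism (with_proj G) ?h"
      "app_iso ?h (with_proj G) = with_proj G"
      using inj im by (auto simp: pre_digraph.digraph_isomorphism_def app_iso_def with_proj_def
        wf_digraph[unfolded with_proj_def])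
    then show "\<exists>h. iso_verts h = f \<and> pre_digraph.digraph_isomorphism (with_proj G) h \<and>
         app_iso h (with_proj G) = with_proj G"
      by (intro exI[of _ ?h]) simp
  next
    assume "\<exists>h. iso_verts h = f \<and> pre_digraph.digraph_isomorphism (with_proj G) h \<and>
         app_iso h (with_proj G) = with_proj G"
    then obtain h where h: "iso_verts h = f" "pre_digraph.digraph_isomorphism (with_proj G) h"
      "app_iso h (with_proj G) = with_proj G" by blast
    have inj: "inj_on f (pverts G)" and im: "f ` pverts G = pverts G"
      and aim: "iso_arcs h ` parcs G = parcs G"
      and th: "iso_tail h = fst" "iso_head h = snd"
      using h by (auto simp: pre_digraph.digraph_isomorphism_def app_iso_def with_proj_def)
    have arc: "iso_arcs h e = (f (fst e), f (snd e))" if "e \<in> parcs G" for e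
      using that h(1,2) th by (auto simp: pre_digraph.digraph_isomorphism_def with_proj_def prod_eq_iff)
    have "(f u, f v) \<in> parcs G \<longleftrightarrow> (u, v) \<in> parcs G" if uv: "u \<in> pverts G" "v \<in> pverts G" for u v
    proof
      assume "(u, v) \<in> parcs G"
      then show "(f u, f v) \<in> parcs G" using arc[of "(u, v)"] aim by force
    next
      assume "(f u, f v) \<in> parcs G"
      then obtain e where e: "e \<in> parcs G" "iso_arcs h e = (f u, f v)" using aim by force
      obtain x y where xy: "e = (x, y)" by (cases e)
      with e arc have "f x = f u" "f y = f v" by auto
      with inj uv V e(1) xy have "x = u" "y = v" by (auto dest: inj_onD)
      with e(1) xy show "(u, v) \<in> parcs G" by simp
    qed
    with inj im show "graph_automorphism G f"
      by (auto simp: graph_automorphism_def bij_betw_def)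
  qed
qed

end

theory Submission
  imports Defs
begin

text \<open>
  Only one thing has to be recovered from the graph: the points of \<open>\<nat>\<close>. The vertices are the
  infinite coinfinite sets, here called moieties. The complement of a moiety \<open>X\<close> is the largest
  moiety disjoint from \<open>X\<close>, so an automorphism \<open>f\<close> commutes with complements; and \<open>X \<subseteq> Y\<close> means
  that \<open>X\<close> is disjoint from the complement of \<open>Y\<close>, so \<open>f\<close> is also an order automorphism of the
  moieties under inclusion.

  A point now appears as the difference of a covering pair, as the covering pairs of this order
  are exactly the pairs \<open>A \<subset> A \<union> {n}\<close> with \<open>n \<notin> A\<close>. The image of such a pair
  is again a covering pair \<open>f A \<subset> f A \<union> {m}\<close>, and the main point is that \<open>m\<close> depends on \<open>n\<close> alone. If \<open>A \<subseteq> X\<close> and \<open>n \<notin> X\<close>, then \<open>m \<notin> f X\<close>, for otherwise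
  \<open>f (A \<union> {n}) \<subseteq> f X\<close>. An arbitrary \<open>X\<close> that avoids \<open>n\<close> is connected to \<open>A\<close> by a short chain of
  inclusions of moieties avoiding \<open>n\<close>, along which this argument can be repeated. Passing to
  complements gives \<open>n \<in> X \<longleftrightarrow> m \<in> f X\<close> for every moiety \<open>X\<close> (lemma \<open>ex_point_image\<close>).
  As moieties separate points, \<open>n \<mapsto> m\<close> is a well-defined injection; the same result for the
  inverse of \<open>f\<close> makes it onto, and it induces \<open>f\<close>.
\<close>

section \<open>Moieties\<close>

definition moieties :: "nat set set" where
  "moieties = {X. infinite X \<and> infinite (- X)}"

lemma moiety_Compl: "X \<in> moieties \<Longrightarrow> - X \<in> moieties"
  by (simp add: moieties_def)

lemma moiety_insert: "X \<in> moieties \<Longrightarrow> insert n X \<in> moieties"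
  by (auto simp: moieties_def Compl_insert)

lemma moiety_between:
  assumes "infinite X" "X \<subseteq> Y" "Y \<subseteq> Z" "infinite (- Z)"
  shows "Y \<in> moieties"
  using assms finite_subset[of X Y] finite_subset[of "- Z" "- Y"] by (auto simp: moieties_def)

lemma infinite_split:
  fixes X :: "'a set"
  assumes "infinite X"
  obtains H where "H \<subseteq> X" "infinite H" "infinite (X - H)"
proof -
  obtain g :: "nat \<Rightarrow> 'a" where g: "inj g" "range g \<subseteq> X"
    using assms infinite_countable_subset by blast
  let ?H = "g ` {n. even n}"
  have inf: "infinite {n::nat. even n}" "infinite {n::nat. odd n}"
    unfolding infinite_nat_iff_unbounded_le
    by (metis dvd_triv_left le_add2 mem_Collect_eq mult_2,
        metis even_Suc dvd_triv_left le_SucI le_add2 mem_Collect_eq mult_2)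
  have "infinite (g ` {n. odd n})" "infinite ?H"
    using inf g(1) by (auto dest!: finite_imageD intro: inj_on_subset)
  moreover have "g ` {n. odd n} \<subseteq> X - ?H"
    using g by (auto dest: injD)
  ultimately have "infinite (X - ?H)"
    using finite_subset by blast
  with that[of ?H] g(2) \<open>infinite ?H\<close> show thesis by blast
qed

lemma ex_moiety: obtains A where "A \<in> moieties" "n \<notin> A"
proof -
  obtain H :: "nat set" where H: "infinite H" "infinite (UNIV - H)"
    using infinite_split[of "UNIV :: nat set"] by auto
  then have "H \<in> moieties" "- H \<in> moieties"
    by (auto simp: moieties_def Compl_eq_Diff_UNIV double_diff)
  with that show thesis by blast
qed

lemma moieties_separate_points:
  assumes "\<And>X. X \<in> moieties \<Longrightarrow> m \<in> X \<longleftrightarrow> n \<in> X"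
  shows "m = n"
proof (rule ccontr)
  assume "m \<noteq> n"
  obtain A where "A \<in> moieties" "n \<notin> A" by (rule ex_moiety)
  with \<open>m \<noteq> n\<close> assms[OF moiety_insert[of A m]] show False by auto
qed

section \<open>Disjointness-preserving permutations of the moieties\<close>

locale moiety_automorphism =
  fixes f :: "nat set \<Rightarrow> nat set"
  assumes bij: "bij_betw f moieties moieties"
    and disjoint_iff:
      "X \<in> moieties \<Longrightarrow> Y \<in> moieties \<Longrightarrow> f X \<inter> f Y = {} \<longleftrightarrow> X \<inter> Y = {}"
begin

lemma image_moiety: "X \<in> moieties \<Longrightarrow> f X \<in> moieties"
  using bij by (auto simp: bij_betw_def)

lemma moiety_preimage:
  assumes "Y \<in> moieties" obtains X where "X \<in> moieties" "Y = f X"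
  using assms bij by (auto simp: bij_betw_def)

text \<open>Disjointness gives \<open>f (- X) \<subseteq> - f X\<close> at once. For the converse, surjectivity is essential:
  the complements of \<open>f X\<close> and of \<open>f (- X)\<close> are themselves images, and their preimages can be
  located relative to \<open>X\<close>.\<close>

lemma image_Compl:
  assumes X: "X \<in> moieties"
  shows "f (- X) = - f X"
proof
  show "f (- X) \<subseteq> - f X"
    using disjoint_iff[OF X moiety_Compl[OF X]] by auto
next
  obtain Z where Z: "Z \<in> moieties" "- f X = f Z"
    using moiety_preimage[OF moiety_Compl[OF image_moiety[OF X]]] by blast
  obtain W where W: "W \<in> moieties" "- f (- X) = f W"
    using moiety_preimage[OF moiety_Compl[OF image_moiety[OF moiety_Compl[OF X]]]] by blast
  \<comment> \<open>\<open>Z\<close> lies outside \<open>X\<close> and \<open>W\<close> inside it, so their images are disjoint.\<close>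
  have "Z \<inter> X = {}" "W \<inter> - X = {}"
    using disjoint_iff[of Z X] disjoint_iff[of W "- X"] Z W X moiety_Compl[OF X] by auto
  then have "Z \<inter> W = {}" by blast
  then have "f Z \<inter> f W = {}" using disjoint_iff Z W by blast
  with Z W show "- f X \<subseteq> f (- X)" by blast
qed

lemma image_subset_iff:
  assumes "X \<in> moieties" "Y \<in> moieties"
  shows "f X \<subseteq> f Y \<longleftrightarrow> X \<subseteq> Y"
  using disjoint_iff[of X "- Y"] assms by (simp add: moiety_Compl image_Compl disjoint_eq_subset_Compl)

text \<open>Covering pairs go to covering pairs: a moiety strictly between \<open>f A\<close> and \<open>f (insert n A)\<close>
  would have a preimage strictly between \<open>A\<close> and \<open>insert n A\<close>.\<close>

lemma image_insert:
  assumes A: "A \<in> moieties" and n: "n \<notin> A"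
  obtains m where "m \<notin> f A" "f (insert n A) = insert m (f A)"
proof -
  have A': "insert n A \<in> moieties" using A by (rule moiety_insert)
  have sub: "f A \<subseteq> f (insert n A)" and nsub: "\<not> f (insert n A) \<subseteq> f A"
    using image_subset_iff A A' n by auto
  from nsub obtain m where m: "m \<in> f (insert n A)" "m \<notin> f A" by blast
  obtain C where C: "C \<in> moieties" "insert m (f A) = f C"
    using moiety_preimage[OF moiety_insert[OF image_moiety[OF A]]] by blast
  have "A \<subseteq> C" using image_subset_iff[OF A C(1)] C(2) by blast
  moreover have "C \<subseteq> insert n A"
    using image_subset_iff[OF C(1) A'] C(2)[symmetric] sub m by simp
  moreover have "C \<noteq> A" using C(2) m by auto
  ultimately have "C = insert n A" by blast
  with that m C show thesis by auto
qed

lemma new_point_notin_image: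
  assumes A: "A \<in> moieties" and m: "f (insert n A) = insert m (f A)"
    and X: "X \<in> moieties" "A \<subseteq> X" "n \<notin> X"
  shows "m \<notin> f X"
proof
  assume "m \<in> f X"
  moreover have "f A \<subseteq> f X" using image_subset_iff A X by blast
  ultimately have "f (insert n A) \<subseteq> f X" using m by simp
  then show False using image_subset_iff[OF moiety_insert[OF A] X(1)] X(3) by blast
qed

text \<open>Shrinking the lower moiety of a covering pair leaves the new point of the image unchanged:
  the point gained in the image of the smaller pair is not in \<open>f A\<close> but is in \<open>insert m (f A)\<close>.\<close>

lemma image_insert_subset:
  assumes A: "A \<in> moieties" "n \<notin> A" and m: "f (insert n A) = insert m (f A)"
    and B: "B \<in> moieties" "B \<subseteq> A"
  shows "f (insert n B) = insert m (f B)"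
proof -
  obtain k where k: "f (insert n B) = insert k (f B)"
    using image_insert[of B n] A B by blast
  have "k \<notin> f A" using new_point_notin_image[OF B(1) k A(1) B(2) A(2)] .
  moreover have "f (insert n B) \<subseteq> f (insert n A)"
    using image_subset_iff moiety_insert A B by (meson insert_mono)
  ultimately show ?thesis using k m by auto
qed

text \<open>If \<open>A \<inter> X\<close> is infinite, it is a moiety below both \<open>A\<close> and \<open>X\<close>, and \<open>A\<close> can be shrunk to it.
  Otherwise \<open>X\<close> is first enlarged by half of \<open>A - X\<close>, which makes the intersection with \<open>A\<close>
  infinite, while the other half of \<open>A - X\<close> keeps the enlarged set coinfinite.\<close>

lemma new_point_notin_image_general:
  assumes A: "A \<in> moieties" "n \<notin> A" and m: "f (insert n A) = insert m (f A)"
    and X: "X \<in> moieties" "n \<notin> X"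
  shows "m \<notin> f X"
proof -
  have meeting: "m \<notin> f Y" if Y: "Y \<in> moieties" "n \<notin> Y" "infinite (A \<inter> Y)" for Y
  proof -
    have B: "A \<inter> Y \<in> moieties"
      using A(1) Y(3) moiety_between[of "A \<inter> Y" "A \<inter> Y" A] by (simp add: moieties_def)
    from image_insert_subset[OF A m B] new_point_notin_image[OF B _ Y(1) _ Y(2)]
    show ?thesis by blast
  qed
  show ?thesis
  proof (cases "finite (A \<inter> X)")
    case True
    then have "infinite (A - X)"
      using A(1) by (metis (no_types, lifting) CollectD Diff_Int2 Diff_infinite_finite
          Int_Diff_Un finite_Un moieties_def)
    then obtain H where H: "H \<subseteq> A - X" "infinite H" "infinite (A - X - H)"
      by (rule infinite_split)
    have "infinite (- (X \<union> H))"
      using H(3) by (rule contrapos_nn) (auto elim: finite_subset[rotated])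
    with X have XH: "X \<union> H \<in> moieties"
      by (intro moiety_between[of X _ "X \<union> H"]) (auto simp: moieties_def)
    have "infinite (A \<inter> (X \<union> H))"
      using H(2) by (rule contrapos_nn) (use H(1) in \<open>auto elim: finite_subset[rotated]\<close>)
    with XH X H(1) A(2) have "m \<notin> f (X \<union> H)" by (intro meeting) auto
    moreover have "f X \<subseteq> f (X \<union> H)" using image_subset_iff X XH by blast
    ultimately show ?thesis by blast
  qed (use meeting X in blast)
qed

lemma ex_point_image: "\<exists>m. \<forall>X \<in> moieties. m \<in> f X \<longleftrightarrow> n \<in> X"
proof -
  obtain A where A: "A \<in> moieties" "n \<notin> A" by (rule ex_moiety)
  then obtain m where m: "f (insert n A) = insert m (f A)" using image_insert by blast
  note notin = new_point_notin_image_general[OF A m]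
  have "m \<in> f X" if "X \<in> moieties" "n \<in> X" for X
    using notin[of "- X"] that by (simp add: moiety_Compl image_Compl)
  with notin show ?thesis by blast
qed

lemma moiety_automorphism_inv_into: "moiety_automorphism (inv_into moieties f)"
proof
  show "bij_betw (inv_into moieties f) moieties moieties"
    using bij by (rule bij_betw_inv_into)
  show "inv_into moieties f X \<inter> inv_into moieties f Y = {} \<longleftrightarrow> X \<inter> Y = {}"
    if "X \<in> moieties" "Y \<in> moieties" for X Y
    using that bij disjoint_iff[of "inv_into moieties f X" "inv_into moieties f Y"]
    by (simp add: bij_betw_def inv_into_into f_inv_into_f)
qed

theorem ex_inducing_permutation: "\<exists>s. bij s \<and> (\<forall>X \<in> moieties. f X = s ` X)"
proof -
  obtain s where s: "\<And>n X. X \<in> moieties \<Longrightarrow> s n \<in> f X \<longleftrightarrow> n \<in> X"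
    using ex_point_image by metis
  have "inj s"
  proof (rule injI)
    fix x y assume "s x = s y"
    then show "x = y" using s by (intro moieties_separate_points) metis
  qed
  moreover have "surj s"
  proof -
    have "\<exists>n. s n = m" for m
    proof -
      obtain n where n: "\<And>Y. Y \<in> moieties \<Longrightarrow> n \<in> inv_into moieties f Y \<longleftrightarrow> m \<in> Y"
        using moiety_automorphism.ex_point_image[OF moiety_automorphism_inv_into] by metis
      have "s n \<in> Y \<longleftrightarrow> m \<in> Y" if "Y \<in> moieties" for Y
        using that n[of Y] s[of "inv_into moieties f Y" n] bij
        by (simp add: bij_betw_def inv_into_into f_inv_into_f)
      then show ?thesis using moieties_separate_points by blast
    qed
    then show ?thesis by (metis surjI)
  qed
  moreover have "f X = s ` X" if "X \<in> moieties" for X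
  proof
    show "s ` X \<subseteq> f X" using s that by blast
    show "f X \<subseteq> s ` X"
    proof
      fix y assume "y \<in> f X"
      moreover obtain x where "y = s x" using \<open>surj s\<close> by blast
      ultimately show "y \<in> s ` X" using s that by blast
    qed
  qed
  ultimately show ?thesis unfolding bij_def by blast
qed

end

section \<open>Automorphisms of the infinite Kneser graph\<close>

theorem corollary2:
  fixes f :: "nat set \<Rightarrow> nat set"
  assumes "graph_automorphism kneser_inf f"
  shows "\<exists>s :: nat \<Rightarrow> nat. bij s \<and> (\<forall>X \<in> pverts kneser_inf. f X = s ` X)"
proof -
  have V: "pverts kneser_inf = moieties"
    by (simp add: pverts_kneser_inf moieties_def Compl_eq_Diff_UNIV)
  have bij: "bij_betw f moieties moieties"
    using assms by (simp add: graph_automorphism_def V)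
  interpret moiety_automorphism f
  proof
    show "f X \<inter> f Y = {} \<longleftrightarrow> X \<inter> Y = {}" if "X \<in> moieties" "Y \<in> moieties" for X Y
      using assms that bij_betwE[OF bij] by (auto simp: graph_automorphism_def parcs_kneser_inf V)
  qed (rule bij)
  show ?thesis using ex_inducing_permutation by (simp add: V)
qed

end
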